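(* Let $\mathbf P=(P,\le,0)$ be a poset with least element $0$ and let $f,g\colon P\to P$ be monotone and orthogonally adjoint. Moreover, assume that in the Dedekind-MacNeille completion $\mathbf D(\mathbf P)$ meet distributes over arbitrary joins, i.e. \[ \Big(\bigvee_{i\in I}A_i\Big)\wedge A=\bigvee_{i\in I}(A_i\wedge A) \] whenever $A\in D(\mathbf P)$ and $A_i\in D(\mathbf P)$ for all $i\in I$. Then there exist monotone mappings $\overline f,\overline g\colon D(\mathbf P)\to D(\mathbf P)$ that are orthogonally adjoint in $\mathbf D(\mathbf P)$ and extend $f$ and $g$, respectively, i.e. $\overline f(L(a))=L(f(a))$ and $\overline g(L(a))=L(g(a))$ for all $a\in P$.
   Context: For a poset $\mathbf P=(P,\le)$ and $C\subseteq P$, $L(C):=\{x\in P\mid x\le c\text{ for all }c\in C\}$, and $L(a):=L(\{a\})$. $D(\mathbf P):=\{L(C)\mid C\subseteq P\}$; $\mathbf D(\mathbf P):=(D(\mathbf P),\subseteq)$ is a complete lattice, the Dedekind-MacNeille completion of $\mathbf P$, and $\mathbf P$ is embedded in it by $x\mapsto L(x)$; if $\mathbf P$ has least element $0$, the least element of $\mathbf D(\mathbf P)$ is $L(0)=\{0\}$. In a poset with least element $0$, $x\wedge y=0$ means that the infimum of $x,y$ exists and equals $0$. Mappings $f,g\colon Q\to Q$ on a poset $(Q,\le,0)$ with least element $0$ are orthogonally adjoint if for all $x,y\in Q$: $f(x)\wedge y=0$ if and only if $x\wedge g(y)=0$. *)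

theory Defs
  imports "HOL-Algebra.Complete_Lattice"
begin

text \<open>
  Posets are carrier-based, since orthogonal adjointness is needed both for the given poset and
  for its completion, whose elements are only some of the subsets of the carrier.
  For \<open>C \<subseteq> carrier P\<close>, the set \<open>L(C)\<close> is \<^term>\<open>Lower P C\<close>.
\<close>

definition DM_completion :: "('a, 'm) gorder_scheme \<Rightarrow> 'a set gorder" where
  "DM_completion P =
     \<lparr>carrier = {Lower P C |C. C \<subseteq> carrier P}, eq = (=), le = (\<subseteq>)\<rparr>"

text \<open>
  \<open>x \<and> y = 0\<close> asserts that the infimum exists, so it is \<^term>\<open>is_glb Q \<bottom>\<^bsub>Q\<^esub> {x, y}\<close> and not an
  equation for \<^const>\<open>meet\<close>, which is unspecified if there is no infimum.
  \<^term>\<open>\<bottom>\<^bsub>Q\<^esub>\<close> is the least element of \<open>Q\<close> provided that one exists.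
\<close>

definition orthogonally_adjoint ::
  "('a, 'm) gorder_scheme \<Rightarrow> ('a \<Rightarrow> 'a) \<Rightarrow> ('a \<Rightarrow> 'a) \<Rightarrow> bool" where
  "orthogonally_adjoint Q f g \<longleftrightarrow>
     (\<forall>x\<in>carrier Q. \<forall>y\<in>carrier Q.
        is_glb Q \<bottom>\<^bsub>Q\<^esub> {f x, y} \<longleftrightarrow> is_glb Q \<bottom>\<^bsub>Q\<^esub> {x, g y})"

lemma partial_order_DM_completion: "partial_order (DM_completion P)"
  by unfold_locales (auto simp: DM_completion_def)

lemma Lower_in_DM_completion: "Lower P C \<in> carrier (DM_completion P)"
proof -
  have "Lower P C = Lower P (C \<inter> carrier P)"
    by (auto simp: Lower_def)
  then show ?thesis
    unfolding DM_completion_def by auto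
qed

lemma is_glb_DM_completion:
  assumes "S \<subseteq> carrier (DM_completion P)"
  shows "is_glb (DM_completion P) (carrier P \<inter> \<Inter>S) S"
proof -
  let ?D = "DM_completion P"
  let ?C = "\<Union>{C. C \<subseteq> carrier P \<and> Lower P C \<in> S}"
  have "Lower P ?C = carrier P \<inter> \<Inter>S"
  proof
    show "Lower P ?C \<subseteq> carrier P \<inter> \<Inter>S"
    proof
      fix x assume x: "x \<in> Lower P ?C"
      have "x \<in> B" if "B \<in> S" for B
      proof -
        from assms that have "B \<in> carrier (DM_completion P)" by blast
        then obtain C where "B = Lower P C" "C \<subseteq> carrier P"
          by (auto simp: DM_completion_def)
        with x that show ?thesis by (auto simp: Lower_def)
      qed
      then show "x \<in> carrier P \<inter> \<Inter>S" using x by (auto simp: Lower_def)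
    qed
    show "carrier P \<inter> \<Inter>S \<subseteq> Lower P ?C"
      by (auto simp: Lower_def)
  qed
  then have "carrier P \<inter> \<Inter>S \<in> carrier ?D"
    using Lower_in_DM_completion[of P ?C] by simp
  moreover have "B \<subseteq> carrier P" if "B \<in> carrier ?D" for B
    using that by (auto simp: DM_completion_def Lower_def)
  moreover have "le ?D = (\<subseteq>)"
    by (simp add: DM_completion_def)
  ultimately show ?thesis
    using assms unfolding greatest_def Lower_def[of ?D] by auto
qed

lemma complete_lattice_DM_completion: "complete_lattice (DM_completion P)"
proof -
  let ?D = "DM_completion P"
  interpret D: partial_order ?D
    by (rule partial_order_DM_completion)
  have "is_glb ?D (carrier P) {}"
    using is_glb_DM_completion[of "{}" P] by simp
  then have "greatest ?D (carrier P) (carrier ?D)"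
    by (simp add: Lower_def)
  then show ?thesis
    using is_glb_DM_completion by (intro D.complete_lattice_criterion1) blast+
qed

lemma bottom_DM_completion:
  assumes "partial_order P" "weak_partial_order_bottom P"
  shows "\<bottom>\<^bsub>DM_completion P\<^esub> = Lower P {\<bottom>\<^bsub>P\<^esub>}" and "Lower P {\<bottom>\<^bsub>P\<^esub>} = {\<bottom>\<^bsub>P\<^esub>}"
proof -
  interpret P: partial_order P by fact
  interpret Pb: weak_partial_order_bottom P by fact
  interpret D: complete_lattice "DM_completion P"
    by (rule complete_lattice_DM_completion)
  show eq: "Lower P {\<bottom>\<^bsub>P\<^esub>} = {\<bottom>\<^bsub>P\<^esub>}"
    using P.le_antisym Pb.bottom_closed Pb.bottom_lower by (auto simp: Lower_def)
  have "\<bottom>\<^bsub>P\<^esub> \<in> A" if "A \<in> carrier (DM_completion P)" for A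
    using that Pb.bottom_closed Pb.bottom_lower by (auto simp: DM_completion_def Lower_def)
  then have "least (DM_completion P) (Lower P {\<bottom>\<^bsub>P\<^esub>}) (carrier (DM_completion P))"
    using Lower_in_DM_completion[of P "{\<bottom>\<^bsub>P\<^esub>}"] unfolding eq
    by (auto simp: least_def) (auto simp: DM_completion_def)
  then show "\<bottom>\<^bsub>DM_completion P\<^esub> = Lower P {\<bottom>\<^bsub>P\<^esub>}"
    using D.bottom_least D.least_unique by blast
qed

end

theory Submission
  imports Defs
begin

text \<open>
  The extension of \<open>f\<close> sends \<open>A\<close> to the join of all \<open>L(f x)\<close> with \<open>x \<in> A\<close>.
  Two elements of the completion are disjoint iff all pairs of their members are disjoint in \<open>P\<close>.
  Distributivity reduces the disjointness of the join from \<open>B\<close> to that of every \<open>L(f x)\<close>, so it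
  says that \<open>f x \<and> y = 0\<close> for all \<open>x \<in> A\<close>, \<open>y \<in> B\<close>; adjointness then transfers pointwise.
\<close>

definition DM_extension :: "('a, 'm) gorder_scheme \<Rightarrow> ('a \<Rightarrow> 'a) \<Rightarrow> 'a set \<Rightarrow> 'a set" where
  "DM_extension P f A = \<Squnion>\<^bsub>DM_completion P\<^esub> ((\<lambda>x. Lower P {f x}) ` A)"

section \<open>Order, binary meets and disjointness inside the completion\<close>

lemma le_DM_completion [simp]: "le (DM_completion P) = (\<subseteq>)"
  by (simp add: DM_completion_def)

lemma DM_completion_subset_carrier:
  "A \<in> carrier (DM_completion P) \<Longrightarrow> A \<subseteq> carrier P"
  by (auto simp: DM_completion_def Lower_def)

text \<open>By transitivity, whatever lies below a lower bound of \<open>C\<close> is again a lower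
  bound of \<open>C\<close>.\<close>

lemma (in partial_order) DM_completion_down_closed:
  assumes "A \<in> carrier (DM_completion L)" "x \<in> A"
  shows "Lower L {x} \<subseteq> A"
proof -
  obtain C where "A = Lower L C" "C \<subseteq> carrier L"
    using assms(1) by (auto simp: DM_completion_def)
  with assms(2) show ?thesis
    by (auto simp: Lower_def intro: le_trans)
qed

lemma image_Lower_subset_DM_completion:
  "(\<lambda>x. Lower P (h x)) ` A \<subseteq> carrier (DM_completion P)"
  by (rule image_subsetI) (rule Lower_in_DM_completion)

lemma is_glb_Int_DM_completion:
  assumes "A \<in> carrier (DM_completion P)" "B \<in> carrier (DM_completion P)"
  shows "is_glb (DM_completion P) (A \<inter> B) {A, B}"
proof -
  \<comment> \<open>The factor \<open>carrier P\<close> serves the infimum of the empty family; here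
    \<open>A\<close> already lies inside it.\<close>
  have "carrier P \<inter> \<Inter>{A, B} = A \<inter> B"
    using DM_completion_subset_carrier[OF assms(1)] by blast
  then show ?thesis
    using is_glb_DM_completion[of "{A, B}" P] assms by simp
qed

text \<open>Infima are unique, so the lattice operation in the distributive law can be computed as
  intersection.\<close>

lemma meet_DM_completion:
  assumes "A \<in> carrier (DM_completion P)" "B \<in> carrier (DM_completion P)"
  shows "A \<sqinter>\<^bsub>DM_completion P\<^esub> B = A \<inter> B"
proof -
  interpret D: complete_lattice "DM_completion P"
    by (rule complete_lattice_DM_completion)
  have "is_glb (DM_completion P) (A \<inter> B) {A, B}"
    by (rule is_glb_Int_DM_completion[OF assms])
  moreover have "is_glb (DM_completion P) (A \<sqinter>\<^bsub>DM_completion P\<^esub> B) {A, B}"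
    using assms by (simp add: meet_def D.inf_glb)
  ultimately show ?thesis
    by (rule D.greatest_unique[symmetric])
qed

text \<open>In the completion the infimum always exists and is the intersection, so by uniqueness
  the claim that bottom is an infimum becomes an equation of sets.\<close>

lemma is_glb_bottom_DM_completion_iff:
  assumes "partial_order P" "weak_partial_order_bottom P"
    and "A \<in> carrier (DM_completion P)" "B \<in> carrier (DM_completion P)"
  shows "is_glb (DM_completion P) \<bottom>\<^bsub>DM_completion P\<^esub> {A, B} \<longleftrightarrow> A \<inter> B = {\<bottom>\<^bsub>P\<^esub>}"
proof -
  interpret D: complete_lattice "DM_completion P"
    by (rule complete_lattice_DM_completion)
  have "is_glb (DM_completion P) (A \<inter> B) {A, B}"
    by (rule is_glb_Int_DM_completion[OF assms(3,4)])
  then show ?thesis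
    using D.greatest_unique bottom_DM_completion[OF assms(1,2)] by metis
qed

section \<open>Disjointness expressed by elements of the poset\<close>

lemma eq_singleton_iff: "b \<in> X \<Longrightarrow> X = {b} \<longleftrightarrow> (\<forall>z\<in>X. z = b)"
  by auto

text \<open>The common lower bounds of \<open>x\<close> and \<open>y\<close> form the intersection
  of their principal ideals. Bottom always belongs to it, hence is its greatest element exactly when
  it is its only one. Existence of the infimum is thereby encoded as a set equation in
  \<open>P\<close>, too.\<close>

lemma is_glb_bottom_iff_Lower_Int:
  assumes "partial_order P" "weak_partial_order_bottom P"
    and "x \<in> carrier P" "y \<in> carrier P"
  shows "is_glb P \<bottom>\<^bsub>P\<^esub> {x, y} \<longleftrightarrow> Lower P {x} \<inter> Lower P {y} = {\<bottom>\<^bsub>P\<^esub>}"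
proof -
  interpret P: partial_order P by fact
  interpret Pb: weak_partial_order_bottom P by fact
  let ?I = "Lower P {x} \<inter> Lower P {y}"
  have eq: "Lower P {x, y} = ?I" and sub: "?I \<subseteq> carrier P"
    by (auto simp: Lower_def)
  have bot: "\<bottom>\<^bsub>P\<^esub> \<in> ?I"
    using assms(3,4) Pb.bottom_closed Pb.bottom_lower by (auto simp: Lower_def)
  have "is_glb P \<bottom>\<^bsub>P\<^esub> {x, y} \<longleftrightarrow> (\<forall>z\<in>?I. z \<sqsubseteq>\<^bsub>P\<^esub> \<bottom>\<^bsub>P\<^esub>)"
    using sub bot unfolding greatest_def eq by simp
  also have "\<dots> \<longleftrightarrow> (\<forall>z\<in>?I. z = \<bottom>\<^bsub>P\<^esub>)"
  proof (rule ball_cong[OF refl])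
    fix z assume "z \<in> ?I"
    then have z: "z \<in> carrier P" using sub by (rule rev_subsetD)
    show "z \<sqsubseteq>\<^bsub>P\<^esub> \<bottom>\<^bsub>P\<^esub> \<longleftrightarrow> z = \<bottom>\<^bsub>P\<^esub>"
    proof
      show "z = \<bottom>\<^bsub>P\<^esub>" if "z \<sqsubseteq>\<^bsub>P\<^esub> \<bottom>\<^bsub>P\<^esub>"
        using that Pb.bottom_lower[OF z] z Pb.bottom_closed by (rule P.le_antisym)
      show "z \<sqsubseteq>\<^bsub>P\<^esub> \<bottom>\<^bsub>P\<^esub>" if "z = \<bottom>\<^bsub>P\<^esub>"
        using Pb.bottom_lower[OF z] unfolding that .
    qed
  qed
  also have "\<dots> \<longleftrightarrow> ?I = {\<bottom>\<^bsub>P\<^esub>}"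
    by (rule eq_singleton_iff[OF bot, symmetric])
  finally show ?thesis .
qed

context
  fixes P :: "('a, 'm) gorder_scheme"
  assumes po: "partial_order P" and bot: "weak_partial_order_bottom P"
begin

interpretation P: partial_order P by (rule po)
interpretation Pb: weak_partial_order_bottom P by (rule bot)
interpretation D: complete_lattice "DM_completion P"
  by (rule complete_lattice_DM_completion)

lemma bottom_in_DM_completion:
  assumes "A \<in> carrier (DM_completion P)"
  shows "\<bottom>\<^bsub>P\<^esub> \<in> A"
  using D.bottom_lower[OF assms]
  unfolding bottom_DM_completion(1)[OF po bot] bottom_DM_completion(2)[OF po bot] by simp

text \<open>Members of the completion are down-sets: the principal ideals of \<open>x\<close> and
  \<open>y\<close> stay inside \<open>A\<close> and \<open>B\<close>, so they can share no more than
  \<open>A\<close> and \<open>B\<close> do. Conversely, an element common to \<open>A\<close> and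
  \<open>B\<close> can be paired with itself.\<close>

lemma DM_completion_disjoint_iff:
  assumes A: "A \<in> carrier (DM_completion P)" and B: "B \<in> carrier (DM_completion P)"
  shows "A \<inter> B = {\<bottom>\<^bsub>P\<^esub>} \<longleftrightarrow> (\<forall>x\<in>A. \<forall>y\<in>B. is_glb P \<bottom>\<^bsub>P\<^esub> {x, y})"
proof -
  have AB: "A \<subseteq> carrier P" "B \<subseteq> carrier P"
    using A B by (simp_all add: DM_completion_subset_carrier)
  have "A \<inter> B = {\<bottom>\<^bsub>P\<^esub>} \<longleftrightarrow>
      (\<forall>x\<in>A. \<forall>y\<in>B. Lower P {x} \<inter> Lower P {y} = {\<bottom>\<^bsub>P\<^esub>})"
  proof (intro iffI ballI)
    fix x y assume disj: "A \<inter> B = {\<bottom>\<^bsub>P\<^esub>}" and xy: "x \<in> A" "y \<in> B"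
    have "Lower P {x} \<inter> Lower P {y} \<subseteq> A \<inter> B"
      using xy by (intro Int_mono P.DM_completion_down_closed A B)
    moreover have "\<bottom>\<^bsub>P\<^esub> \<in> Lower P {x} \<inter> Lower P {y}"
      by (intro IntI bottom_in_DM_completion Lower_in_DM_completion)
    ultimately show "Lower P {x} \<inter> Lower P {y} = {\<bottom>\<^bsub>P\<^esub>}"
      unfolding disj by blast
  next
    assume "\<forall>x\<in>A. \<forall>y\<in>B. Lower P {x} \<inter> Lower P {y} = {\<bottom>\<^bsub>P\<^esub>}"
    \<comment> \<open>For \<open>z\<close> in both sets, the choice \<open>x = y = z\<close> forces
      the ideal of \<open>z\<close>, and so \<open>z\<close> itself, to be trivial.\<close>
    moreover have "z \<in> Lower P {z}" if "z \<in> A" for z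
      using that AB by (auto simp: Lower_def)
    ultimately have "A \<inter> B \<subseteq> {\<bottom>\<^bsub>P\<^esub>}" by blast
    then show "A \<inter> B = {\<bottom>\<^bsub>P\<^esub>}"
      using bottom_in_DM_completion[OF A] bottom_in_DM_completion[OF B] by blast
  qed
  also have "\<dots> \<longleftrightarrow> (\<forall>x\<in>A. \<forall>y\<in>B. is_glb P \<bottom>\<^bsub>P\<^esub> {x, y})"
    using AB by (intro ball_cong refl is_glb_bottom_iff_Lower_Int[OF po bot, symmetric]) auto
  finally show ?thesis .
qed

section \<open>The join extension of a single map\<close>

lemma DM_extension_closed: "DM_extension P f A \<in> carrier (DM_completion P)"
  unfolding DM_extension_def by (rule D.sup_closed[OF image_Lower_subset_DM_completion])

lemma Lower_subset_DM_extension: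
  assumes "x \<in> A"
  shows "Lower P {f x} \<subseteq> DM_extension P f A"
  using D.sup_upper[OF image_Lower_subset_DM_completion imageI, OF assms, of "\<lambda>x. {f x}"]
  unfolding DM_extension_def le_DM_completion .

text \<open>With \<open>Lower_subset_DM_extension\<close> this gives the universal property of the
  join, which in general is larger than the union of the ideals.\<close>

lemma DM_extension_subsetI:
  assumes "B \<in> carrier (DM_completion P)" "\<And>x. x \<in> A \<Longrightarrow> Lower P {f x} \<subseteq> B"
  shows "DM_extension P f A \<subseteq> B"
proof -
  have "X \<sqsubseteq>\<^bsub>DM_completion P\<^esub> B" if "X \<in> (\<lambda>x. Lower P {f x}) ` A" for X
    using that assms(2) unfolding le_DM_completion by blast
  then show ?thesis
    using D.sup_least[OF image_Lower_subset_DM_completion assms(1), of "\<lambda>x. {f x}" A]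
    unfolding DM_extension_def le_DM_completion by blast
qed

text \<open>A larger argument only adds further ideals to the family being joined.\<close>

lemma isotone_DM_extension: "Mono\<^bsub>DM_completion P\<^esub> (DM_extension P f)"
proof (rule isotoneI)
  fix A B assume "A \<sqsubseteq>\<^bsub>DM_completion P\<^esub> B"
  then have "DM_extension P f A \<subseteq> DM_extension P f B"
    by (intro DM_extension_subsetI[OF DM_extension_closed] Lower_subset_DM_extension) auto
  then show "DM_extension P f A \<sqsubseteq>\<^bsub>DM_completion P\<^esub> DM_extension P f B"
    by simp
qed (rule D.weak_partial_order_axioms)+

text \<open>By monotonicity of \<open>f\<close>, the ideal of \<open>f a\<close> is the largest in
  the family, and it occurs there because \<open>a\<close> lies in its own ideal.\<close>

lemma DM_extension_Lower:
  assumes "f \<in> carrier P \<rightarrow> carrier P" "Mono\<^bsub>P\<^esub> f" "a \<in> carrier P"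
  shows "DM_extension P f (Lower P {a}) = Lower P {f a}"
proof
  show "DM_extension P f (Lower P {a}) \<subseteq> Lower P {f a}"
  proof (rule DM_extension_subsetI[OF Lower_in_DM_completion])
    fix x assume "x \<in> Lower P {a}"
    then have "x \<in> carrier P" "x \<sqsubseteq>\<^bsub>P\<^esub> a" using assms(3) by (auto simp: Lower_def)
    then have "f x \<in> carrier P" "f x \<sqsubseteq>\<^bsub>P\<^esub> f a" "f a \<in> carrier P"
      using assms by (auto simp: isotone_def)
    then show "Lower P {f x} \<subseteq> Lower P {f a}"
      by (auto simp: Lower_def intro: P.le_trans)
  qed
  show "Lower P {f a} \<subseteq> DM_extension P f (Lower P {a})"
    using assms(3) by (intro Lower_subset_DM_extension) (auto simp: Lower_def)
qed

section \<open>Disjointness and adjointness under distributivity\<close>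

context
  assumes distrib: "\<And>A S. A \<in> carrier (DM_completion P) \<Longrightarrow> S \<subseteq> carrier (DM_completion P) \<Longrightarrow>
     (\<Squnion>\<^bsub>DM_completion P\<^esub> S) \<sqinter>\<^bsub>DM_completion P\<^esub> A
       = \<Squnion>\<^bsub>DM_completion P\<^esub> ((\<lambda>B. B \<sqinter>\<^bsub>DM_completion P\<^esub> A) ` S)"
begin

text \<open>From left to right, each \<open>f x\<close> is itself a member of the extension. From
  right to left, a member of the join need not lie below any \<open>f x\<close>; distributivity
  moves the meet with \<open>B\<close> inside the join, where every term is trivial.\<close>

lemma DM_extension_disjoint_iff:
  assumes f: "f \<in> carrier P \<rightarrow> carrier P"
    and A: "A \<in> carrier (DM_completion P)" and B: "B \<in> carrier (DM_completion P)"
  shows "is_glb (DM_completion P) \<bottom>\<^bsub>DM_completion P\<^esub> {DM_extension P f A, B} \<longleftrightarrow>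
    (\<forall>x\<in>A. \<forall>y\<in>B. is_glb P \<bottom>\<^bsub>P\<^esub> {f x, y})"
    (is "?L \<longleftrightarrow> ?R")
proof
  assume ?L
  then have "DM_extension P f A \<inter> B = {\<bottom>\<^bsub>P\<^esub>}"
    using is_glb_bottom_DM_completion_iff[OF po bot DM_extension_closed B] by simp
  then have "\<forall>u\<in>DM_extension P f A. \<forall>y\<in>B. is_glb P \<bottom>\<^bsub>P\<^esub> {u, y}"
    using DM_completion_disjoint_iff[OF DM_extension_closed B] by simp
  moreover have "f x \<in> DM_extension P f A" if "x \<in> A" for x
  proof -
    have "f x \<in> Lower P {f x}"
      using that f DM_completion_subset_carrier[OF A] by (auto simp: Lower_def)
    then show ?thesis
      using Lower_subset_DM_extension[OF that] by blast
  qed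
  ultimately show ?R by blast
next
  assume R: ?R
  let ?S = "(\<lambda>x. Lower P {f x}) ` A"
  have S: "?S \<subseteq> carrier (DM_completion P)"
    by (rule image_Lower_subset_DM_completion)
  have eq: "Lower P {f x} \<inter> B = {\<bottom>\<^bsub>P\<^esub>}" if x: "x \<in> A" for x
  proof -
    have fx: "f x \<in> carrier P"
      using x f DM_completion_subset_carrier[OF A] by auto
    have "z = \<bottom>\<^bsub>P\<^esub>" if z: "z \<in> Lower P {f x}" "z \<in> B" for z
    proof -
      have "z \<in> carrier P" using z(1) by (auto simp: Lower_def)
      \<comment> \<open>The hypothesis is applied to \<open>f x\<close> and \<open>y = z\<close>, so
        that \<open>z\<close> lies in an intersection known to be trivial.\<close>
      then have "z \<in> Lower P {f x} \<inter> Lower P {z}" using z by (auto simp: Lower_def)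
      also have "\<dots> = {\<bottom>\<^bsub>P\<^esub>}"
        using R x z(2) is_glb_bottom_iff_Lower_Int[OF po bot fx \<open>z \<in> carrier P\<close>] by simp
      finally show ?thesis by simp
    qed
    then show ?thesis
      using bottom_in_DM_completion[OF B]
        bottom_in_DM_completion[OF Lower_in_DM_completion[of P "{f x}"]] by blast
  qed
  have "DM_extension P f A \<inter> B = DM_extension P f A \<sqinter>\<^bsub>DM_completion P\<^esub> B"
    by (rule meet_DM_completion[OF DM_extension_closed B, symmetric])
  also have "\<dots> = \<Squnion>\<^bsub>DM_completion P\<^esub> ((\<lambda>C. C \<sqinter>\<^bsub>DM_completion P\<^esub> B) ` ?S)"
    unfolding DM_extension_def by (rule distrib[OF B S])
  \<comment> \<open>The trivial set is written as the ideal of bottom so that the join becomes the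
    extension of the constant map to bottom, which the rules for extensions then evaluate.\<close>
  also have "((\<lambda>C. C \<sqinter>\<^bsub>DM_completion P\<^esub> B) ` ?S) = (\<lambda>x. Lower P {\<bottom>\<^bsub>P\<^esub>}) ` A"
    using eq meet_DM_completion[OF Lower_in_DM_completion B] bottom_DM_completion(2)[OF po bot]
    by (simp add: image_image)
  also have "\<Squnion>\<^bsub>DM_completion P\<^esub> \<dots> = DM_extension P (\<lambda>_. \<bottom>\<^bsub>P\<^esub>) A"
    by (simp add: DM_extension_def)
  also have "\<dots> = {\<bottom>\<^bsub>P\<^esub>}"
  proof
    show "DM_extension P (\<lambda>_. \<bottom>\<^bsub>P\<^esub>) A \<subseteq> {\<bottom>\<^bsub>P\<^esub>}"
      using DM_extension_subsetI[OF Lower_in_DM_completion[of P "{\<bottom>\<^bsub>P\<^esub>}"], of A "\<lambda>_. \<bottom>\<^bsub>P\<^esub>"]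
        bottom_DM_completion(2)[OF po bot] by simp
    show "{\<bottom>\<^bsub>P\<^esub>} \<subseteq> DM_extension P (\<lambda>_. \<bottom>\<^bsub>P\<^esub>) A"
      using bottom_in_DM_completion[OF DM_extension_closed] by blast
  qed
  finally show ?L
    using is_glb_bottom_DM_completion_iff[OF po bot DM_extension_closed B] by simp
qed

text \<open>The criterion turns disjointness from an extension into a condition on pairs of elements
  of \<open>P\<close>, where the given adjointness replaces \<open>f x, y\<close> by
  \<open>x, g y\<close>.\<close>

lemma orthogonally_adjoint_DM_extension:
  assumes f: "f \<in> carrier P \<rightarrow> carrier P" and g: "g \<in> carrier P \<rightarrow> carrier P"
    and adj: "orthogonally_adjoint P f g"
  shows "orthogonally_adjoint (DM_completion P) (DM_extension P f) (DM_extension P g)"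
  unfolding orthogonally_adjoint_def
proof (intro ballI)
  fix A B assume A: "A \<in> carrier (DM_completion P)" and B: "B \<in> carrier (DM_completion P)"
  have "is_glb (DM_completion P) \<bottom>\<^bsub>DM_completion P\<^esub> {DM_extension P f A, B} \<longleftrightarrow>
      (\<forall>x\<in>A. \<forall>y\<in>B. is_glb P \<bottom>\<^bsub>P\<^esub> {f x, y})"
    by (rule DM_extension_disjoint_iff[OF f A B])
  also have "\<dots> \<longleftrightarrow> (\<forall>x\<in>A. \<forall>y\<in>B. is_glb P \<bottom>\<^bsub>P\<^esub> {x, g y})"
    using adj DM_completion_subset_carrier[OF A] DM_completion_subset_carrier[OF B]
    by (intro ball_cong refl) (simp add: orthogonally_adjoint_def subset_iff)
  \<comment> \<open>Disjointness is symmetric; the swap brings \<open>g\<close> to the left, as the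
    criterion for \<open>g\<close> with \<open>A\<close> and \<open>B\<close> exchanged
    requires.\<close>
  also have "\<dots> \<longleftrightarrow> (\<forall>y\<in>B. \<forall>x\<in>A. is_glb P \<bottom>\<^bsub>P\<^esub> {g y, x})"
    by (auto simp: insert_commute)
  also have "\<dots> \<longleftrightarrow>
      is_glb (DM_completion P) \<bottom>\<^bsub>DM_completion P\<^esub> {DM_extension P g B, A}"
    by (rule DM_extension_disjoint_iff[OF g B A, symmetric])
  finally show "is_glb (DM_completion P) \<bottom>\<^bsub>DM_completion P\<^esub> {DM_extension P f A, B} \<longleftrightarrow>
      is_glb (DM_completion P) \<bottom>\<^bsub>DM_completion P\<^esub> {A, DM_extension P g B}"
    by (simp only: insert_commute)
qed

end

end

theorem theorem24:
  fixes P :: "('a, 'm) gorder_scheme" and f g :: "'a \<Rightarrow> 'a"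
  assumes "partial_order P" and "weak_partial_order_bottom P"
    and "f \<in> carrier P \<rightarrow> carrier P" and "g \<in> carrier P \<rightarrow> carrier P"
    and "Mono\<^bsub>P\<^esub> f" and "Mono\<^bsub>P\<^esub> g"
    and "orthogonally_adjoint P f g"
    and "\<And>A S. A \<in> carrier (DM_completion P) \<Longrightarrow> S \<subseteq> carrier (DM_completion P) \<Longrightarrow>
           (\<Squnion>\<^bsub>DM_completion P\<^esub> S) \<sqinter>\<^bsub>DM_completion P\<^esub> A
             = \<Squnion>\<^bsub>DM_completion P\<^esub> ((\<lambda>B. B \<sqinter>\<^bsub>DM_completion P\<^esub> A) ` S)"
  shows "\<exists>f' g'. f' \<in> carrier (DM_completion P) \<rightarrow> carrier (DM_completion P)
           \<and> g' \<in> carrier (DM_completion P) \<rightarrow> carrier (DM_completion P)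
           \<and> Mono\<^bsub>DM_completion P\<^esub> f' \<and> Mono\<^bsub>DM_completion P\<^esub> g'
           \<and> orthogonally_adjoint (DM_completion P) f' g'
           \<and> (\<forall>a\<in>carrier P. f' (Lower P {a}) = Lower P {f a})
           \<and> (\<forall>a\<in>carrier P. g' (Lower P {a}) = Lower P {g a})"
proof (rule exI[of _ "DM_extension P f"], rule exI[of _ "DM_extension P g"], intro conjI ballI)
  show "orthogonally_adjoint (DM_completion P) (DM_extension P f) (DM_extension P g)"
    by (rule orthogonally_adjoint_DM_extension[OF assms(1,2,8,3,4,7)])
  show "DM_extension P f \<in> carrier (DM_completion P) \<rightarrow> carrier (DM_completion P)"
    "DM_extension P g \<in> carrier (DM_completion P) \<rightarrow> carrier (DM_completion P)"
    by (rule funcsetI, rule DM_extension_closed[OF assms(1,2)])+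
  show "Mono\<^bsub>DM_completion P\<^esub> (DM_extension P f)" "Mono\<^bsub>DM_completion P\<^esub> (DM_extension P g)"
    by (rule isotone_DM_extension[OF assms(1,2)])+
  \<comment> \<open>Agreement on principal ideals is where monotonicity of \<open>f\<close> and
    \<open>g\<close> enters.\<close>
  fix a assume "a \<in> carrier P"
  then show "DM_extension P f (Lower P {a}) = Lower P {f a}"
    "DM_extension P g (Lower P {a}) = Lower P {g a}"
    by (rule DM_extension_Lower[OF assms(1,2,3,5)], rule DM_extension_Lower[OF assms(1,2,4,6)])
qed

end
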